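(* Let $L:\mathsf{T}(\mathsf{S}^2)^n\to\mathbb{R}$ be a Lagrangian and let $\tilde L(q,\omega)=L(q,S(\omega)q)$ be the modified Lagrangian, where $S(\omega)q$ stands for $(S(\omega_1)q_1,\dots,S(\omega_n)q_n)$, with generalized force $f_i\in\mathbb{R}^3$ acting on $q_i$. The Euler--Lagrange equations on $(\mathsf{S}^2)^n$ are $$\left(I_3-q_iq_i^T\right)\left\{\frac{d}{dt}\left(\frac{\partial\tilde L(q,\omega)}{\partial\omega_i}\right)-2S(\omega_i)\frac{\partial\tilde L(q,\omega)}{\partial\omega_i}\right\}-S(q_i)\left(\frac{\partial\tilde L(q,\omega)}{\partial q_i}+f_i\right)=0,\qquad i=1,\dots,n.$$ That is, a curve $q:[t_0,t_f]\to(\mathsf{S}^2)^n$ with angular velocities $\omega_i=S(q_i)\dot q_i$ (so $\dot q_i=S(\omega_i)q_i$, $\omega_i\cdot q_i=0$) satisfies the Lagrange--d'Alembert principle $\delta\tilde{\mathfrak{G}}=-\delta\mathcal{W}$ for all admissible variations if and only if these equations hold along $(q,\omega)$.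
   Context: $\mathsf{S}^2=\{q\in\mathbb{R}^3:\|q\|=1\}$, $\mathsf{T}_q\mathsf{S}^2=\{\xi\in\mathbb{R}^3: q\cdot\xi=0\}$, $I_3$ is the $3\times3$ identity matrix, and $S(x)$ is the skew-symmetric $3\times 3$ matrix with $S(x)y=x\times y$. For a curve $q_i$ in $\mathsf{S}^2$ the angular velocity is $\omega_i=S(q_i)\dot q_i$; it satisfies $\omega_i\cdot q_i=0$ and $\dot q_i=\omega_i\times q_i=S(\omega_i)q_i$. Write $\omega=(\omega_1,\dots,\omega_n)\in\mathbb{R}^{3n}$. All functions and curves are assumed sufficiently smooth (curves $q$ of class $C^2$). Functions of $(q,\omega)$ are regarded as smooth functions on an open neighborhood in $\mathbb{R}^{3n}\times\mathbb{R}^{3n}$ of the set $\{(q,\omega): q_i\in\mathsf{S}^2,\ \omega_i\cdot q_i=0\}$, and $\partial\tilde L/\partial q_i$, $\partial\tilde L/\partial\omega_i$ are the ordinary gradients there ($q$ and $\omega$ treated as independent arguments). Admissible variations: $q_i^\epsilon(t)=e^{\epsilon S(\gamma_i(t))}q_i(t)$, where $\gamma_i:[t_0,t_f]\to\mathbb{R}^3$ is continuously differentiable with $\gamma_i(t_0)=\gamma_i(t_f)=0$ and $\gamma_i(t)\cdot q_i(t)=0$ for all $t$; $\delta q_i=S(\gamma_i)q_i$, and the variation of $\omega_i$ is the one induced by $\omega_i=S(q_i)\dot q_i$. The modified action is $\tilde{\mathfrak{G}}=\int_{t_0}^{t_f}\tilde L(q,\omega)\,dt$ and $\delta\tilde{\mathfrak{G}}$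 is its derivative at $\epsilon=0$ along the variation. The virtual work of the generalized forces (given continuous $\mathbb{R}^3$-valued functions along the motion) is $\sum_i f_i\cdot\delta q_i$, and $\delta\mathcal{W}=\int_{t_0}^{t_f}\sum_{i=1}^n f_i\cdot\delta q_i\,dt$. The Euler--Lagrange equations are the equations characterizing the curves satisfying $\delta\tilde{\mathfrak{G}}=-\delta\mathcal{W}$ for all admissible variations. *)

theory Defs
  imports "HOL-Analysis.Analysis"
begin

definition skew :: "real^3 \<Rightarrow> real^3^3" where
  "skew x = matrix (cross3 x)"

lemma skew_mult: "skew x *v y = cross3 x y"
proof -
  have "linear (cross3 x)"
    by (intro linearI) (simp_all add: cross_add_right cross_mult_right)
  then show ?thesis
    by (simp add: skew_def matrix_works linear_matrix_vector_mul_eq)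
qed

lemma transpose_skew: "transpose (skew x) = - skew x"
  by (simp add: skew_def matrix_def transpose_def vec_eq_iff forall_3 cross3_def axis_def)

definition outer :: "real^3 \<Rightarrow> real^3^3" where
  "outer x = (columnvector x :: real^1^3) ** (rowvector x :: real^3^1)"

(* The class operations * and ^ on real^3^3 act entrywise, so they give neither
   the matrix power nor the matrix exponential. *)
primrec matpow :: "real^3^3 \<Rightarrow> nat \<Rightarrow> real^3^3" where
  "matpow A 0 = mat 1"
| "matpow A (Suc k) = A ** matpow A k"

definition mexp :: "real^3^3 \<Rightarrow> real^3^3" where
  "mexp A = (\<Sum>k. (1 / fact k) *\<^sub>R matpow A k)"

definition spheres :: "(real^3^'n) set" where
  "spheres = {q. \<forall>i. norm (q $ i) = 1}"

definition phase_set :: "((real^3^'n) \<times> (real^3^'n)) set" where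
  "phase_set = {(q, w). q \<in> spheres \<and> (\<forall>i. w $ i \<bullet> q $ i = 0)}"

definition C2_on :: "'a::real_normed_vector set \<Rightarrow> ('a \<Rightarrow> real) \<Rightarrow> bool" where
  "C2_on U F \<longleftrightarrow>
    (\<exists>(F' :: 'a \<Rightarrow> 'a \<Rightarrow>\<^sub>L real) (F'' :: 'a \<Rightarrow> 'a \<Rightarrow>\<^sub>L ('a \<Rightarrow>\<^sub>L real)).
      (\<forall>x\<in>U. (F has_derivative blinfun_apply (F' x)) (at x)) \<and>
      (\<forall>x\<in>U. (F' has_derivative blinfun_apply (F'' x)) (at x)) \<and>
      continuous_on U F'')"

(* Derivatives at the end points of {a..b} are one-sided; the library's
   C1_differentiable_on asks for two-sided derivatives there. *)
definition C1_curve :: "real \<Rightarrow> real \<Rightarrow> (real \<Rightarrow> 'a::real_normed_vector) \<Rightarrow> bool" where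
  "C1_curve a b x \<longleftrightarrow>
    (\<exists>x'. (\<forall>t\<in>{a..b}. (x has_vector_derivative x' t) (at t within {a..b})) \<and>
          continuous_on {a..b} x')"

definition C2_curve :: "real \<Rightarrow> real \<Rightarrow> (real \<Rightarrow> 'a::real_normed_vector) \<Rightarrow> bool" where
  "C2_curve a b x \<longleftrightarrow>
    (\<exists>x'. (\<forall>t\<in>{a..b}. (x has_vector_derivative x' t) (at t within {a..b})) \<and>
          C1_curve a b x')"

abbreviation time_deriv ::
    "real \<Rightarrow> real \<Rightarrow> (real \<Rightarrow> 'a::real_normed_vector) \<Rightarrow> real \<Rightarrow> 'a" where
  "time_deriv a b x t \<equiv> vector_derivative x (at t within {a..b})"

definition ang_vel :: "real \<Rightarrow> real \<Rightarrow> (real \<Rightarrow> real^3^'n) \<Rightarrow> real \<Rightarrow> real^3^'n" where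
  "ang_vel a b q t = (\<chi> i. skew (q t $ i) *v time_deriv a b (\<lambda>s. q s $ i) t)"

(* (q, w) |-> (q, S(w) q) maps phase_set bijectively onto the tangent bundle of the
   product of spheres, so only the values of L on that bundle are used.  Lt is any
   extension of the modified Lagrangian to an open neighbourhood U of phase_set. *)
definition modified_lagrangian ::
    "((real^3^'n) \<times> (real^3^'n) \<Rightarrow> real) \<Rightarrow> ((real^3^'n) \<times> (real^3^'n)) set \<Rightarrow>
     ((real^3^'n) \<times> (real^3^'n) \<Rightarrow> real) \<Rightarrow> bool" where
  "modified_lagrangian L U Lt \<longleftrightarrow>
    open U \<and> phase_set \<subseteq> U \<and> C2_on U Lt \<and>
    (\<forall>(q, w)\<in>phase_set. Lt (q, w) = L (q, \<chi> i. skew (w $ i) *v (q $ i)))"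

definition gradient :: "('a::real_inner \<Rightarrow> real) \<Rightarrow> 'a \<Rightarrow> 'a" where
  "gradient F x = (THE D. GDERIV F x :> D)"

definition replace :: "'b^'n \<Rightarrow> 'n \<Rightarrow> 'b \<Rightarrow> 'b^'n" where
  "replace q i x = (\<chi> j. if j = i then x else q $ j)"

definition grad_q ::
    "((real^3^'n) \<times> (real^3^'n) \<Rightarrow> real) \<Rightarrow> 'n \<Rightarrow> real^3^'n \<Rightarrow> real^3^'n \<Rightarrow> real^3" where
  "grad_q Lt i q w = gradient (\<lambda>x. Lt (replace q i x, w)) (q $ i)"

definition grad_w ::
    "((real^3^'n) \<times> (real^3^'n) \<Rightarrow> real) \<Rightarrow> 'n \<Rightarrow> real^3^'n \<Rightarrow> real^3^'n \<Rightarrow> real^3" where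
  "grad_w Lt i q w = gradient (\<lambda>x. Lt (q, replace w i x)) (w $ i)"

definition admissible ::
    "real \<Rightarrow> real \<Rightarrow> (real \<Rightarrow> real^3^'n) \<Rightarrow> (real \<Rightarrow> real^3^'n) \<Rightarrow> bool" where
  "admissible a b q \<gamma> \<longleftrightarrow>
    C1_curve a b \<gamma> \<and> \<gamma> a = 0 \<and> \<gamma> b = 0 \<and>
    (\<forall>t\<in>{a..b}. \<forall>i. \<gamma> t $ i \<bullet> q t $ i = 0)"

definition varied ::
    "(real \<Rightarrow> real^3^'n) \<Rightarrow> (real \<Rightarrow> real^3^'n) \<Rightarrow> real \<Rightarrow> real \<Rightarrow> real^3^'n" where
  "varied q \<gamma> \<epsilon> t = (\<chi> i. mexp (\<epsilon> *\<^sub>R skew (\<gamma> t $ i)) *v (q t $ i))"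

definition action ::
    "((real^3^'n) \<times> (real^3^'n) \<Rightarrow> real) \<Rightarrow> real \<Rightarrow> real \<Rightarrow> (real \<Rightarrow> real^3^'n) \<Rightarrow> real" where
  "action Lt a b q = integral {a..b} (\<lambda>t. Lt (q t, ang_vel a b q t))"

definition virtual_work ::
    "(real \<Rightarrow> real^3^'n) \<Rightarrow> real \<Rightarrow> real \<Rightarrow> (real \<Rightarrow> real^3^'n) \<Rightarrow> (real \<Rightarrow> real^3^'n) \<Rightarrow> real" where
  "virtual_work f a b q \<gamma> =
    integral {a..b} (\<lambda>t. \<Sum>i\<in>UNIV. f t $ i \<bullet> (skew (\<gamma> t $ i) *v (q t $ i)))"

definition lagrange_dalembert ::
    "((real^3^'n) \<times> (real^3^'n) \<Rightarrow> real) \<Rightarrow> (real \<Rightarrow> real^3^'n) \<Rightarrow> real \<Rightarrow> real \<Rightarrow>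
     (real \<Rightarrow> real^3^'n) \<Rightarrow> bool" where
  "lagrange_dalembert Lt f a b q \<longleftrightarrow>
    (\<forall>\<gamma>. admissible a b q \<gamma> \<longrightarrow>
      ((\<lambda>\<epsilon>. action Lt a b (varied q \<gamma> \<epsilon>)) has_real_derivative
        (- virtual_work f a b q \<gamma>)) (at 0))"

end

theory Submission
  imports Defs
begin

text \<open>
The principle and the equations are two forms of one identity: the integral of
\<open>\<Sum>i. \<gamma>\<^sub>i \<bullet> E\<^sub>i\<close> vanishes, where
\<open>E = q \<times> (\<partial>L/\<partial>q + f) - (d/dt \<partial>L/\<partial>\<omega> - 2 \<omega> \<times> \<partial>L/\<partial>\<omega>)\<close> for each body
(\<open>residual\<close> below).

The factor 2 comes from the sphere. For \<open>\<gamma> \<bottom> q\<close>, the variation \<open>\<delta>q = \<gamma> \<times> q\<close> changes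
\<open>\<omega> = q \<times> q'\<close> by the sum of \<open>\<delta>q \<times> q' = (\<gamma> \<bullet> q') q\<close> and \<open>q \<times> \<delta>q' = \<gamma>' + (\<gamma> \<bullet> q') q\<close>, and
\<open>\<omega> \<times> \<gamma> = - (\<gamma> \<bullet> q') q\<close>, so \<open>\<delta>\<omega> = \<gamma>' - 2 \<omega> \<times> \<gamma>\<close> (\<open>ang_e_0_perp\<close>). Inserting this into the
chain rule, moving the derivative from \<open>\<gamma>\<close> to \<open>\<partial>L/\<partial>\<omega>\<close> by parts (the boundary terms vanish with \<open>\<gamma>\<close>)
and rotating the triple products gives \<open>\<delta>G + \<delta>W = \<integral> \<Sum>i. \<gamma>\<^sub>i \<bullet> E\<^sub>i\<close> (\<open>first_variation_by_parts\<close>).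

Since \<open>\<gamma>\<^sub>i\<close> is only free in the plane perpendicular to \<open>q\<^sub>i\<close>, the identity controls exactly the
projection \<open>(I - q q\<^sup>T) E\<close>, which is the stated equation up to sign, the term \<open>q \<times> (\<dots>)\<close> being
tangent already. To extract it, one uses \<open>\<gamma> = \<phi> (I - q q\<^sup>T) v\<close> with a fixed vector \<open>v\<close> and
a \<open>C\<^sup>1\<close> function \<open>\<phi>\<close>. This \<open>\<gamma>\<close> is \<open>C\<^sup>1\<close>, whereas \<open>(I - q q\<^sup>T) E\<close> itself is in general only
continuous and no admissible variation (\<open>integral_zero_iff_projection\<close>).

The analytic work lies in the derivative of the action (\<open>action_derivative\<close>). It is taken under
the integral sign, which requires the varied curve and its angular velocity to be differentiable
in \<open>\<epsilon>\<close> with a derivative that is jointly continuous in \<open>\<epsilon>\<close> and \<open>t\<close>, also where \<open>\<gamma> = 0\<close>. On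
\<open>v \<bottom> u\<close> the exponential is \<open>cos \<bar>u\<bar> v + (sin \<bar>u\<bar> / \<bar>u\<bar>) u \<times> v\<close>, and both coefficients are
entire power series in \<open>\<bar>u\<bar>\<^sup>2\<close>. Hence everything is an explicit polynomial expression in such
series, in \<open>\<epsilon>\<close>, and in \<open>\<gamma>\<close>, \<open>q\<close> and their derivatives.
\<close>

section \<open>The exponential of a skew-symmetric matrix on a perpendicular vector\<close>

definition power_sum :: "(nat \<Rightarrow> real) \<Rightarrow> real \<Rightarrow> real" where
  "power_sum c x = (\<Sum>n. c n * x ^ n)"

definition entire_coeffs :: "(nat \<Rightarrow> real) \<Rightarrow> bool" where
  "entire_coeffs c \<longleftrightarrow> (\<forall>x. summable (\<lambda>n. c n * x ^ n))"

lemma entire_coeffs_diffs: "entire_coeffs c \<Longrightarrow> entire_coeffs (diffs c)"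
  unfolding entire_coeffs_def by (metis termdiff_converges_all)

lemma DERIV_power_sum: "entire_coeffs c \<Longrightarrow> (power_sum c has_real_derivative power_sum (diffs c) x) (at x)"
  unfolding entire_coeffs_def power_sum_def[abs_def] by (rule termdiffs_strong_converges_everywhere) auto

lemma DERIV_power_sum_chain [derivative_intros]:
  assumes "entire_coeffs c" "(g has_real_derivative g') (at x within S)"
  shows "((\<lambda>x. power_sum c (g x)) has_real_derivative power_sum (diffs c) (g x) * g') (at x within S)"
  using DERIV_chain2[OF DERIV_power_sum[OF assms(1)] assms(2)] .

lemma continuous_on_power_sum [continuous_intros]:
  assumes "entire_coeffs c" "continuous_on S g"
  shows "continuous_on S (\<lambda>x. power_sum c (g x))"
proof -
  have "continuous_on UNIV (power_sum c)"
    using DERIV_power_sum[OF assms(1)] DERIV_isCont by (simp add: continuous_on_eq_continuous_at) blast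
  then show ?thesis
    by (rule continuous_on_compose2[OF _ assms(2)]) auto
qed

lemma power_sum_0 [simp]: "power_sum c 0 = c 0"
  unfolding power_sum_def by (rule powser_zero)

text \<open>Coefficients of \<open>cos (sqrt x)\<close> and \<open>sin (sqrt x) / sqrt x\<close>: in the variable \<open>x = r\<^sup>2\<close> both
functions are entire, so no case distinction at \<open>r = 0\<close> arises when they are differentiated.\<close>
definition cos_sqrt_coeff :: "nat \<Rightarrow> real" where
  "cos_sqrt_coeff n = (- 1) ^ n / fact (2 * n)"

definition sinc_sqrt_coeff :: "nat \<Rightarrow> real" where
  "sinc_sqrt_coeff n = (- 1) ^ n / fact (2 * n + 1)"

lemma entire_coeffsI:
  assumes "\<And>n. \<bar>c n\<bar> \<le> 1 / fact n"
  shows "entire_coeffs c"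
  unfolding entire_coeffs_def
proof
  fix x :: real
  have "summable (\<lambda>n. inverse (fact n) * \<bar>x\<bar> ^ n)" by (rule summable_exp)
  moreover have "norm (c n * x ^ n) \<le> inverse (fact n) * \<bar>x\<bar> ^ n" for n
    using mult_right_mono[OF assms[of n], of "\<bar>x\<bar> ^ n"] by (simp add: abs_mult power_abs inverse_eq_divide)
  ultimately show "summable (\<lambda>n. c n * x ^ n)"
    by (rule summable_comparison_test'[where N = 0])
qed

lemma entire_cos_sqrt: "entire_coeffs cos_sqrt_coeff"
  by (rule entire_coeffsI)
    (auto simp: cos_sqrt_coeff_def abs_mult power_abs intro!: divide_left_mono fact_mono)

lemma entire_sinc_sqrt: "entire_coeffs sinc_sqrt_coeff"
proof (rule entire_coeffsI)
  fix n
  have "fact n \<le> (fact (2 * n + 1) :: real)" by (rule fact_mono) simp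
  then show "\<bar>sinc_sqrt_coeff n\<bar> \<le> 1 / fact n"
    unfolding sinc_sqrt_coeff_def by (simp add: abs_mult power_abs divide_left_mono del: fact_Suc)
qed

lemma power_sum_cos_sqrt: "power_sum cos_sqrt_coeff (r\<^sup>2) = cos r"
  using cos_paired[of r] by (simp add: power_sum_def sums_iff cos_sqrt_coeff_def power_mult)

lemma power_sum_sinc_sqrt: "r * power_sum sinc_sqrt_coeff (r\<^sup>2) = sin r"
proof -
  have "(\<lambda>n. r * (sinc_sqrt_coeff n * (r\<^sup>2) ^ n)) sums (r * power_sum sinc_sqrt_coeff (r\<^sup>2))"
    unfolding power_sum_def
    using entire_sinc_sqrt by (intro sums_mult summable_sums) (auto simp: entire_coeffs_def)
  moreover have "r * (sinc_sqrt_coeff n * (r\<^sup>2) ^ n) = (- 1) ^ n / fact (2 * n + 1) * r ^ (2 * n + 1)" for n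
    by (simp add: sinc_sqrt_coeff_def power_mult[symmetric] field_simps del: fact_Suc)
  ultimately show ?thesis
    using sin_paired[of r] sums_unique2 by (simp del: fact_Suc) blast
qed

lemma cos_sinc_sqrt_pythagoras:
  assumes "x \<ge> 0"
  shows "(power_sum cos_sqrt_coeff x)\<^sup>2 + x * (power_sum sinc_sqrt_coeff x)\<^sup>2 = 1"
proof -
  have "(power_sum cos_sqrt_coeff ((sqrt x)\<^sup>2))\<^sup>2 + (sqrt x * power_sum sinc_sqrt_coeff ((sqrt x)\<^sup>2))\<^sup>2 = 1"
    unfolding power_sum_cos_sqrt power_sum_sinc_sqrt by simp
  then show ?thesis using assms by (simp add: power_mult_distrib)
qed

text \<open>The characteristic equation of a skew matrix; it reduces all its powers to the first two.\<close>
lemma skew_cubed: "skew a ** (skew a ** skew a) = - (a \<bullet> a) *\<^sub>R skew a"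
proof -
  have "cross3 a (cross3 a (cross3 a x)) = - (a \<bullet> a) *\<^sub>R cross3 a x" for x
    by (simp add: Lagrange dot_cross_self cross_mult_right Cross3.right_diff_distrib)
  then show ?thesis
    by (simp add: matrix_eq matrix_vector_mul_assoc[symmetric] skew_mult scaleR_matrix_vector_assoc[symmetric]
        del: scaleR_minus_left)
qed

lemma matpow_skew:
  "matpow (skew a) (2 * k + 1) = (- (a \<bullet> a)) ^ k *\<^sub>R skew a"
  "matpow (skew a) (2 * k + 2) = (- (a \<bullet> a)) ^ k *\<^sub>R (skew a ** skew a)"
proof -
  show *: "matpow (skew a) (2 * k + 1) = (- (a \<bullet> a)) ^ k *\<^sub>R skew a" for k
  proof (induction k)
    case (Suc k)
    have "matpow (skew a) (2 * Suc k + 1) = skew a ** (skew a ** matpow (skew a) (2 * k + 1))"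
      by simp
    also have "\<dots> = (- (a \<bullet> a)) ^ k *\<^sub>R (skew a ** (skew a ** skew a))"
      unfolding Suc.IH by (simp add: matrix_scalar_ac scalar_matrix_assoc[symmetric])
    finally show ?case by (simp add: skew_cubed mult.commute)
  qed simp
  show "matpow (skew a) (2 * k + 2) = (- (a \<bullet> a)) ^ k *\<^sub>R (skew a ** skew a)"
    using *[of k] by (simp add: matrix_scalar_ac scalar_matrix_assoc[symmetric])
qed

text \<open>Rodrigues' formula on \<open>v \<bottom> a\<close>. The exponential series splits into its constant term, the odd
powers, which are multiples of \<open>skew a\<close>, and the positive even powers, which are multiples of
\<open>(skew a)\<^sup>2\<close>; the last act on \<open>v\<close> as the scalar \<open>- a \<bullet> a\<close> and complete the cosine.\<close>
lemma mexp_skew_perp: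
  assumes "a \<bullet> v = 0"
  shows "mexp (skew a) *v v =
    power_sum cos_sqrt_coeff (a \<bullet> a) *\<^sub>R v + power_sum sinc_sqrt_coeff (a \<bullet> a) *\<^sub>R cross3 a v"
proof -
  define A where "A = skew a"
  define x where "x = a \<bullet> a"
  \<comment> \<open>the coefficients of \<open>(1 - cos (sqrt x)) / x\<close>, which multiplies the square of the matrix\<close>
  define tail where "tail n = - cos_sqrt_coeff (Suc n)" for n
  have sm: "summable (\<lambda>n. c n * y ^ n)" if "entire_coeffs c" for c and y :: real
    using that by (simp add: entire_coeffs_def)
  have cos_tail: "power_sum cos_sqrt_coeff x = 1 - x * power_sum tail x" and sm_tail: "summable (\<lambda>n. tail n * x ^ n)"
  proof -
    have s: "summable (\<lambda>n. cos_sqrt_coeff (Suc n) * x ^ n)"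
      using sm[OF entire_cos_sqrt] by (simp add: summable_powser_split_head)
    then show "summable (\<lambda>n. tail n * x ^ n)" unfolding tail_def by (simp add: summable_minus)
    have "power_sum tail x = - (\<Sum>n. cos_sqrt_coeff (Suc n) * x ^ n)"
      unfolding tail_def power_sum_def using suminf_minus[OF s] by simp
    moreover have "power_sum cos_sqrt_coeff x = cos_sqrt_coeff 0 + (\<Sum>n. cos_sqrt_coeff (Suc n) * x ^ n) * x"
      unfolding power_sum_def by (rule powser_split_head(1)[OF sm[OF entire_cos_sqrt]])
    ultimately show "power_sum cos_sqrt_coeff x = 1 - x * power_sum tail x"
      by (simp add: cos_sqrt_coeff_def mult.commute)
  qed
  define T where "T k = (1 / fact k) *\<^sub>R matpow A k" for k
  have odd: "(\<lambda>k. if odd k then T k else 0) sums (power_sum sinc_sqrt_coeff x *\<^sub>R A)"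
  proof -
    have "(\<lambda>k. if odd (2 * k + 1) then T (2 * k + 1) else 0) sums (power_sum sinc_sqrt_coeff x *\<^sub>R A)"
    proof -
      have "(if odd (2 * k + 1) then T (2 * k + 1) else 0) = (sinc_sqrt_coeff k * x ^ k) *\<^sub>R A" for k
        unfolding T_def A_def x_def matpow_skew sinc_sqrt_coeff_def
        by (simp add: power_minus[of "a \<bullet> a"] del: fact_Suc)
      then show ?thesis
        unfolding power_sum_def by (simp only:) (intro sums_scaleR_left summable_sums sm entire_sinc_sqrt)
    qed
    then show ?thesis
      by (subst (asm) sums_mono_reindex[where g = "\<lambda>k. 2 * k + 1"])
        (auto simp: strict_mono_def elim!: oddE)
  qed
  have even: "(\<lambda>k. if even k \<and> k \<noteq> 0 then T k else 0) sums (power_sum tail x *\<^sub>R (A ** A))"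
  proof -
    have "(\<lambda>k. if even (2 * k + 2) \<and> 2 * k + 2 \<noteq> 0 then T (2 * k + 2) else 0)
        sums (power_sum tail x *\<^sub>R (A ** A))"
    proof -
      have "(if even (2 * k + 2) \<and> 2 * k + 2 \<noteq> 0 then T (2 * k + 2) else 0)
          = (tail k * x ^ k) *\<^sub>R (A ** A)" for k
        unfolding T_def A_def x_def matpow_skew tail_def cos_sqrt_coeff_def
        by (simp add: power_minus[of "a \<bullet> a"] del: fact_Suc)
      then show ?thesis
        unfolding power_sum_def by (simp only:) (intro sums_scaleR_left summable_sums sm_tail)
    qed
    moreover have "k \<in> range (\<lambda>k. 2 * k + 2)" if k: "even k" "k \<noteq> 0" for k :: nat
    proof -
      obtain m where "k = 2 * m" using k(1) by (auto elim: evenE)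
      then show ?thesis using k by (intro range_eqI[of _ _ "m - 1"]) auto
    qed
    ultimately show ?thesis
      by (subst (asm) sums_mono_reindex[where g = "\<lambda>k. 2 * k + 2"])
        (auto simp: strict_mono_def)
  qed
  have zero: "(\<lambda>k. if k = 0 then mat 1 else 0) sums (mat 1 :: real^3^3)"
    using sums_single[of 0 "\<lambda>_. mat 1 :: real^3^3"] by simp
  have split: "T k = (if k = 0 then mat 1 else 0) +
      ((if odd k then T k else 0) + (if even k \<and> k \<noteq> 0 then T k else 0))" for k
    by (simp add: T_def)
  have "T sums (mat 1 + (power_sum sinc_sqrt_coeff x *\<^sub>R A + power_sum tail x *\<^sub>R (A ** A)))"
    by (subst split[abs_def]) (intro sums_add zero odd even)
  then have "mexp A = mat 1 + (power_sum sinc_sqrt_coeff x *\<^sub>R A + power_sum tail x *\<^sub>R (A ** A))"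
    unfolding mexp_def T_def by (rule sums_unique[symmetric])
  moreover have "(A ** A) *v v = - x *\<^sub>R v"
    using assms by (simp add: A_def x_def matrix_vector_mul_assoc[symmetric] skew_mult Lagrange)
  ultimately show ?thesis
    unfolding A_def[symmetric] x_def[symmetric] cos_tail
    by (simp add: matrix_vector_mult_add_rdistrib scaleR_matrix_vector_assoc[symmetric] A_def skew_mult
       scaleR_left_diff_distrib)
qed

section \<open>Derivatives of products and of vector-valued curves\<close>

lemma has_vector_derivative_cross3 [derivative_intros]:
  assumes "(f has_vector_derivative f') (at t within S)" "(g has_vector_derivative g') (at t within S)"
  shows "((\<lambda>t. cross3 (f t) (g t)) has_vector_derivative
    cross3 (f t) g' + cross3 f' (g t)) (at t within S)"
  using bounded_bilinear.has_vector_derivative[OF _ assms] bilinear_cross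
  by (auto simp: bilinear_conv_bounded_bilinear)

lemma has_real_derivative_inner:
  assumes "(f has_vector_derivative f') (at t within S)" "(g has_vector_derivative g') (at t within S)"
  shows "((\<lambda>t. f t \<bullet> g t) has_real_derivative (f t \<bullet> g' + f' \<bullet> g t)) (at t within S)"
  unfolding has_real_derivative_iff_has_vector_derivative
  by (rule bounded_bilinear.has_vector_derivative[OF bounded_bilinear_inner assms])

lemma has_vector_derivative_compose_has_derivative:
  assumes "(g has_vector_derivative g') (at t within S)" "(F has_derivative D) (at (g t))"
  shows "((\<lambda>t. F (g t)) has_vector_derivative D g') (at t within S)"
proof -
  have "linear D" using assms(2) has_derivative_bounded_linear bounded_linear.linear by blast
  then show ?thesis
    using has_derivative_compose[OF assms(1)[unfolded has_vector_derivative_def] assms(2)]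
    by (simp add: has_vector_derivative_def linear_cmul)
qed

lemma bounded_linear_axis: "bounded_linear (axis i :: 'a::real_normed_vector \<Rightarrow> 'a^'n)"
proof (rule bounded_linear_intro[where K = 1])
  fix x :: 'a
  have "norm (axis i x :: 'a^'n) \<le> (\<Sum>j\<in>UNIV. norm ((axis i x :: 'a^'n) $ j))"
    unfolding norm_vec_def by (rule L2_set_le_sum) simp
  also have "\<dots> = norm x" by (simp add: axis_def if_distrib[of norm] cong: if_cong)
  finally show "norm (axis i x :: 'a^'n) \<le> norm x * 1" by simp
qed (auto simp: axis_def vec_eq_iff)

lemma vec_lambda_eq_sum_axis: "(\<chi> i. f i) = (\<Sum>i\<in>UNIV. axis i (f i))"
  for f :: "'n::finite \<Rightarrow> 'a::real_normed_vector"
  by (simp add: vec_eq_iff axis_def)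

lemma has_vector_derivative_vec_lambda:
  fixes f :: "real \<Rightarrow> 'n::finite \<Rightarrow> 'a::real_normed_vector"
  assumes "\<And>i. ((\<lambda>t. f t i) has_vector_derivative f' i) F"
  shows "((\<lambda>t. \<chi> i. f t i) has_vector_derivative (\<chi> i. f' i)) F"
  unfolding vec_lambda_eq_sum_axis
  by (intro has_vector_derivative_sum bounded_linear.has_vector_derivative[OF bounded_linear_axis] assms)

lemma has_vector_derivative_vec_nth:
  assumes "(f has_vector_derivative f') F"
  shows "((\<lambda>t. f t $ i) has_vector_derivative f' $ i) F"
  by (rule bounded_linear.has_vector_derivative[OF bounded_linear_vec_nth assms])

lemma linear_pair_vec_eq_sum:
  fixes D :: "('a::real_normed_vector^'n) \<times> ('b::real_normed_vector^'m) \<Rightarrow> real"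
  assumes "linear D"
  shows "D (u, v) = (\<Sum>i\<in>UNIV. D (axis i (u $ i), 0)) + (\<Sum>i\<in>UNIV. D (0, axis i (v $ i)))"
proof -
  have "(u, v) = (\<Sum>i\<in>UNIV. (axis i (u $ i), 0)) + (\<Sum>i\<in>UNIV. (0, axis i (v $ i)))"
    using vec_lambda_eq_sum_axis[of "vec_nth u"] vec_lambda_eq_sum_axis[of "vec_nth v"]
    by (simp add: prod_eq_iff fst_sum snd_sum)
  then show ?thesis
    by (simp add: linear_add[OF assms] linear_sum[OF assms])
qed

section \<open>The rotated curve and its angular velocity\<close>

abbreviation "c0 \<equiv> power_sum cos_sqrt_coeff"
abbreviation "c1 \<equiv> power_sum (diffs cos_sqrt_coeff)"
abbreviation "c2 \<equiv> power_sum (diffs (diffs cos_sqrt_coeff))"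
abbreviation "s0 \<equiv> power_sum sinc_sqrt_coeff"
abbreviation "s1 \<equiv> power_sum (diffs sinc_sqrt_coeff)"
abbreviation "s2 \<equiv> power_sum (diffs (diffs sinc_sqrt_coeff))"

lemmas entire_intros = entire_coeffs_diffs entire_cos_sqrt entire_sinc_sqrt

text \<open>\<open>rot e u v\<close> is \<open>exp (e S(u)) v\<close> for \<open>u \<bottom> v\<close>. The suffix \<open>_e\<close> marks the derivative in \<open>e\<close> and
\<open>_t\<close> the derivative along curves \<open>u\<close>, \<open>v\<close> with velocities \<open>u'\<close>, \<open>v'\<close>; \<open>ang\<close> is the angular
velocity \<open>q \<times> q'\<close> of the rotated curve.\<close>
definition rot :: "real \<Rightarrow> real^3 \<Rightarrow> real^3 \<Rightarrow> real^3" where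
  "rot e u v = c0 (e\<^sup>2 * (u \<bullet> u)) *\<^sub>R v + (e * s0 (e\<^sup>2 * (u \<bullet> u))) *\<^sub>R cross3 u v"

definition rot_e :: "real \<Rightarrow> real^3 \<Rightarrow> real^3 \<Rightarrow> real^3" where
  "rot_e e u v = (let g = u \<bullet> u; x = e\<^sup>2 * g in
    (2 * e * g * c1 x) *\<^sub>R v + (s0 x + 2 * e\<^sup>2 * g * s1 x) *\<^sub>R cross3 u v)"

definition rot_t :: "real \<Rightarrow> real^3 \<Rightarrow> real^3 \<Rightarrow> real^3 \<Rightarrow> real^3 \<Rightarrow> real^3" where
  "rot_t e u u' v v' = (let h = 2 * (u \<bullet> u'); x = e\<^sup>2 * (u \<bullet> u) in
    (e\<^sup>2 * h * c1 x) *\<^sub>R v + c0 x *\<^sub>R v' +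
    (e ^ 3 * h * s1 x) *\<^sub>R cross3 u v + (e * s0 x) *\<^sub>R (cross3 u' v + cross3 u v'))"

definition rot_te :: "real \<Rightarrow> real^3 \<Rightarrow> real^3 \<Rightarrow> real^3 \<Rightarrow> real^3 \<Rightarrow> real^3" where
  "rot_te e u u' v v' = (let g = u \<bullet> u; h = 2 * (u \<bullet> u'); x = e\<^sup>2 * g in
    (2 * e * h * c1 x + 2 * e ^ 3 * g * h * c2 x) *\<^sub>R v + (2 * e * g * c1 x) *\<^sub>R v' +
    (3 * e\<^sup>2 * h * s1 x + 2 * e ^ 4 * g * h * s2 x) *\<^sub>R cross3 u v +
    (s0 x + 2 * e\<^sup>2 * g * s1 x) *\<^sub>R (cross3 u' v + cross3 u v'))"

definition ang :: "real \<Rightarrow> real^3 \<Rightarrow> real^3 \<Rightarrow> real^3 \<Rightarrow> real^3 \<Rightarrow> real^3" where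
  "ang e u u' v v' = cross3 (rot e u v) (rot_t e u u' v v')"

definition ang_e :: "real \<Rightarrow> real^3 \<Rightarrow> real^3 \<Rightarrow> real^3 \<Rightarrow> real^3 \<Rightarrow> real^3" where
  "ang_e e u u' v v' = cross3 (rot e u v) (rot_te e u u' v v') + cross3 (rot_e e u v) (rot_t e u u' v v')"

lemma has_vector_derivative_rot_e:
  "((\<lambda>e. rot e u v) has_vector_derivative rot_e e u v) (at e)"
  unfolding rot_def rot_e_def Let_def
  by (auto intro!: derivative_eq_intros entire_intros simp: algebra_simps power2_eq_square)

lemma has_vector_derivative_rot_t:
  assumes "(u has_vector_derivative u') (at t within S)" "(v has_vector_derivative v') (at t within S)"
  shows "((\<lambda>t. rot e (u t) (v t)) has_vector_derivative rot_t e (u t) u' (v t) v') (at t within S)"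
  unfolding rot_def rot_t_def Let_def
  by (auto intro!: derivative_eq_intros has_real_derivative_inner assms entire_intros
      simp: algebra_simps power2_eq_square power3_eq_cube inner_commute)

lemma has_vector_derivative_rot_te:
  "((\<lambda>e. rot_t e u u' v v') has_vector_derivative rot_te e u u' v v') (at e)"
  unfolding rot_t_def rot_te_def Let_def
  by (auto intro!: derivative_eq_intros entire_intros
      simp: algebra_simps power2_eq_square power3_eq_cube power4_eq_xxxx)

lemma has_vector_derivative_ang_e:
  "((\<lambda>e. ang e u u' v v') has_vector_derivative ang_e e u u' v v') (at e)"
  unfolding ang_def ang_e_def
  by (intro has_vector_derivative_cross3 has_vector_derivative_rot_e has_vector_derivative_rot_te)

lemma continuous_on_rot:
  fixes e :: "'a::t2_space \<Rightarrow> real"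
  assumes "continuous_on S e" "continuous_on S u" "continuous_on S v"
  shows "continuous_on S (\<lambda>z. rot (e z) (u z) (v z))"
    and "continuous_on S (\<lambda>z. rot_e (e z) (u z) (v z))"
  unfolding rot_def rot_e_def Let_def
  by (intro continuous_intros continuous_on_cross assms entire_intros)+

lemma continuous_on_ang:
  fixes e :: "'a::t2_space \<Rightarrow> real"
  assumes "continuous_on S e" "continuous_on S u" "continuous_on S u'"
    "continuous_on S v" "continuous_on S v'"
  shows "continuous_on S (\<lambda>z. ang (e z) (u z) (u' z) (v z) (v' z))"
    and "continuous_on S (\<lambda>z. ang_e (e z) (u z) (u' z) (v z) (v' z))"
  unfolding ang_def ang_e_def rot_t_def rot_te_def Let_def
  by (intro continuous_intros continuous_on_cross continuous_on_rot assms entire_intros)+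

lemma rot_at_0 [simp]:
  "rot 0 u v = v" "rot_e 0 u v = cross3 u v" "ang 0 u u' v v' = cross3 v v'"
  "ang_e 0 u u' v v' = cross3 v (cross3 u' v + cross3 u v') + cross3 (cross3 u v) v'"
  by (simp_all add: rot_def rot_e_def ang_def ang_e_def rot_t_def rot_te_def
      cos_sqrt_coeff_def sinc_sqrt_coeff_def)

text \<open>Varied curves stay on the sphere, so that the Lagrangian is defined along them for every \<open>e\<close>.\<close>
lemma norm_rot:
  assumes "u \<bullet> v = 0" "norm v = 1"
  shows "norm (rot e u v) = 1"
proof -
  have vv: "v \<bullet> v = 1" using assms(2) by (simp add: norm_eq_1)
  have "cross3 u v \<bullet> cross3 u v = u \<bullet> u"
    using norm_cross_dot[of u v] assms by (simp add: power2_norm_eq_inner)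
  then have "rot e u v \<bullet> rot e u v =
      (c0 (e\<^sup>2 * (u \<bullet> u)))\<^sup>2 + (e\<^sup>2 * (u \<bullet> u)) * (s0 (e\<^sup>2 * (u \<bullet> u)))\<^sup>2"
    by (simp add: rot_def inner_add_left inner_add_right dot_cross_self vv power2_eq_square)
  also have "\<dots> = 1" by (rule cos_sinc_sqrt_pythagoras) simp
  finally show ?thesis by (simp add: norm_eq_1)
qed

lemma mexp_skew_eq_rot:
  assumes "u \<bullet> v = 0"
  shows "mexp (e *\<^sub>R skew u) *v v = rot e u v"
proof -
  have "e *\<^sub>R skew u = skew (e *\<^sub>R u)"
    by (simp add: matrix_eq skew_mult cross_mult_left scaleR_matrix_vector_assoc[symmetric])
  then show ?thesis
    using mexp_skew_perp[of "e *\<^sub>R u" v] assms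
    by (simp add: rot_def cross_mult_left power2_eq_square mult.assoc mult.commute)
qed

text \<open>The variation of the angular velocity, \<open>\<delta>\<omega> = \<gamma>' - 2 \<omega> \<times> \<gamma>\<close>. Expanding the double products
leaves \<open>\<gamma>' + 2 (\<gamma> \<bullet> q') q\<close>, and \<open>\<omega> \<times> \<gamma> = - (\<gamma> \<bullet> q') q\<close> for \<open>\<omega> = q \<times> q'\<close> and \<open>\<gamma> \<bottom> q\<close>.\<close>
lemma ang_e_0_perp:
  assumes "v \<bullet> v = 1" "v \<bullet> v' = 0" "u \<bullet> v = 0" "u' \<bullet> v + u \<bullet> v' = 0"
  shows "ang_e 0 u u' v v' = u' - 2 *\<^sub>R cross3 (cross3 v v') u"
proof -
  have "u' \<bullet> v = - (u \<bullet> v')" using assms(4) by linarith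
  then have vu': "v \<bullet> u' = - (u \<bullet> v')" by (simp add: inner_commute)
  have vu: "v \<bullet> u = 0" using assms(3) by (simp add: inner_commute)
  have *: "cross3 (cross3 x y) z = (x \<bullet> z) *\<^sub>R y - (y \<bullet> z) *\<^sub>R x" for x y z
    using cross_skew[of "cross3 x y" z] by (simp add: Lagrange inner_commute)
  show ?thesis
    by (simp add: * Lagrange assms vu vu' inner_commute[of v' u] cross_add_right) (simp add: vec_eq_iff)
qed

section \<open>Partial gradients\<close>

text \<open>The description in \<open>gradient_def\<close> is met exactly by the Riesz representative of the derivative.\<close>
lemma inner_gradient:
  fixes F :: "'a::euclidean_space \<Rightarrow> real"
  assumes "(F has_derivative D) (at x)"
  shows "gradient F x \<bullet> h = D h"
proof -
  have lin: "linear D" using assms has_derivative_bounded_linear bounded_linear.linear by blast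
  define G where "G = (\<Sum>b\<in>Basis. D b *\<^sub>R b)"
  have D: "D h = h \<bullet> G" for h
  proof -
    have "D h = D (\<Sum>b\<in>Basis. (h \<bullet> b) *\<^sub>R b)" by (simp add: euclidean_representation)
    also have "\<dots> = h \<bullet> G"
      by (simp add: G_def linear_sum[OF lin] linear_cmul[OF lin] inner_sum_right mult.commute)
    finally show ?thesis .
  qed
  have "GDERIV F x :> G'  \<longleftrightarrow> G' = G" for G'
  proof
    assume "GDERIV F x :> G'"
    then have "(\<lambda>h. h \<bullet> G') = D"
      unfolding gderiv_def using assms has_derivative_unique by blast
    then have "h \<bullet> G' = h \<bullet> G" for h using D by metis
    then show "G' = G" using vector_eq_ldot by blast
  next
    have "D = (\<lambda>h. h \<bullet> G)" using D by blast
    moreover assume "G' = G"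
    ultimately show "GDERIV F x :> G'"
      unfolding gderiv_def using assms by simp
  qed
  then have "gradient F x = G" unfolding gradient_def by (blast intro: the_equality)
  then show ?thesis by (simp add: D inner_commute)
qed

lemma has_derivative_replace:
  fixes q :: "'a::real_normed_vector^'n"
  shows "((\<lambda>x. replace q i x) has_derivative axis i) (at x)"
proof -
  have "replace q i = (\<lambda>x. replace q i 0 + axis i x)"
    by (auto simp: fun_eq_iff vec_eq_iff replace_def axis_def)
  moreover have "((\<lambda>x. replace q i 0 + axis i x) has_derivative (\<lambda>h. 0 + axis i h)) (at x)"
    by (intro has_derivative_add has_derivative_const bounded_linear_imp_has_derivative bounded_linear_axis)
  ultimately show ?thesis by simp
qed

lemma replace_nth [simp]: "replace q i (q $ i) = q"
  by (simp add: replace_def vec_eq_iff)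

lemma inner_grad_q:
  assumes "(F has_derivative D) (at (q, w))"
  shows "grad_q F i q w \<bullet> h = D (axis i h, 0)"
  unfolding grad_q_def
  by (rule inner_gradient, rule has_derivative_compose[where g = F and g' = D])
    (auto intro!: derivative_eq_intros has_derivative_replace assms)

lemma inner_grad_w:
  assumes "(F has_derivative D) (at (q, w))"
  shows "grad_w F i q w \<bullet> h = D (0, axis i h)"
  unfolding grad_w_def
  by (rule inner_gradient, rule has_derivative_compose[where g = F and g' = D])
    (auto intro!: derivative_eq_intros has_derivative_replace assms)

text \<open>Turns the weak description of a gradient into coordinates, the form in which its
dependence on the base point can be differentiated.\<close>
lemma vec_eq_sum_Basis:
  fixes x :: "'a::euclidean_space"
  assumes "\<And>h. x \<bullet> h = D h"
  shows "x = (\<Sum>b\<in>Basis. D b *\<^sub>R b)"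
  using euclidean_representation[of x] by (simp add: assms)

lemma grad_q_eq_sum:
  assumes "(F has_derivative D) (at (q, w))"
  shows "grad_q F i q w = (\<Sum>b\<in>Basis. D (axis i b, 0) *\<^sub>R b)"
  using inner_grad_q[OF assms] by (rule vec_eq_sum_Basis)

lemma grad_w_eq_sum:
  assumes "(F has_derivative D) (at (q, w))"
  shows "grad_w F i q w = (\<Sum>b\<in>Basis. D (0, axis i b) *\<^sub>R b)"
  using inner_grad_w[OF assms] by (rule vec_eq_sum_Basis)

lemma derivative_eq_sum_grads:
  fixes F :: "(real^3^'n) \<times> (real^3^'n) \<Rightarrow> real"
  assumes "(F has_derivative D) (at (q, w))"
  shows "D (u, v) = (\<Sum>i\<in>UNIV. grad_q F i q w \<bullet> u $ i + grad_w F i q w \<bullet> v $ i)"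
  using linear_pair_vec_eq_sum[of D u v] assms has_derivative_bounded_linear bounded_linear.linear
  by (auto simp: inner_grad_q[OF assms] inner_grad_w[OF assms] sum.distrib)

section \<open>The fundamental lemma of the calculus of variations\<close>

text \<open>Instead of bump functions, the test functions are \<open>w p\<close> with \<open>w t = (t - a) (b - t)\<close> and \<open>p\<close> a
polynomial. By Weierstrass, \<open>p\<close> can be chosen uniformly close to \<open>g\<close>, whence \<open>\<integral> w g\<^sup>2 = 0\<close>.
As \<open>w > 0\<close> inside the interval, \<open>g\<close> vanishes there, and at the end points by continuity.\<close>
lemma fundamental_lemma_C1:
  fixes g :: "real \<Rightarrow> real"
  assumes "a < b" "continuous_on {a..b} g"
    and test: "\<And>\<phi> \<phi>'. (\<And>t. (\<phi> has_real_derivative \<phi>' t) (at t)) \<Longrightarrow> continuous_on UNIV \<phi>' \<Longrightarrow>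
      \<phi> a = 0 \<Longrightarrow> \<phi> b = 0 \<Longrightarrow> integral {a..b} (\<lambda>t. \<phi> t * g t) = 0"
    and t: "t \<in> {a..b}"
  shows "g t = 0"
proof -
  define w where "w t = (t - a) * (b - t)" for t :: real
  have w_nonneg: "w t \<ge> 0" if "t \<in> {a..b}" for t using that by (auto simp: w_def)
  have [continuous_intros]: "continuous_on S w" for S unfolding w_def[abs_def] by (intro continuous_intros)
  define K where "K = integral {a..b} (\<lambda>t. w t * \<bar>g t\<bar>)"
  have K: "K \<ge> 0" unfolding K_def
    by (intro integral_nonneg integrable_continuous_real continuous_intros assms) (auto intro!: mult_nonneg_nonneg w_nonneg)
  have bound: "integral {a..b} (\<lambda>t. w t * (g t)\<^sup>2) \<le> e * K" if "e > 0" for e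
  proof -
    obtain p where p: "real_polynomial_function p" "\<And>x. x \<in> {a..b} \<Longrightarrow> \<bar>g x - p x\<bar> < e"
      using Stone_Weierstrass_real_polynomial_function[OF compact_Icc assms(2) \<open>e > 0\<close>] by blast
    obtain p' where p': "real_polynomial_function p'" "\<And>x. (p has_real_derivative p' x) (at x)"
      using has_real_derivative_polynomial_function[OF p(1)] by blast
    have cont: "continuous_on S p" "continuous_on S p'" for S
      using p(1) p'(1) by (auto simp: real_polynomial_function_eq intro: continuous_on_polymonial_function)
    have "integral {a..b} (\<lambda>t. (w t * p t) * g t) = 0"
    proof (rule test)
      show "((\<lambda>t. w t * p t) has_real_derivative (b - t - (t - a)) * p t + w t * p' t) (at t)" for t
        unfolding w_def by (auto intro!: derivative_eq_intros p'(2) simp: algebra_simps)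
    qed (auto simp: w_def intro!: continuous_intros cont)
    then have "integral {a..b} (\<lambda>t. w t * (g t)\<^sup>2) =
        integral {a..b} (\<lambda>t. w t * (g t)\<^sup>2) - integral {a..b} (\<lambda>t. (w t * p t) * g t)" by simp
    also have "\<dots> = integral {a..b} (\<lambda>t. w t * (g t)\<^sup>2 - (w t * p t) * g t)"
      by (intro integral_diff[symmetric] integrable_continuous_real continuous_intros cont assms)
    also have "\<dots> \<le> integral {a..b} (\<lambda>t. e * (w t * \<bar>g t\<bar>))"
    proof (intro integral_le integrable_continuous_real continuous_intros cont assms)
      fix t assume t: "t \<in> {a..b}"
      have "w t * (g t)\<^sup>2 - (w t * p t) * g t = (w t * g t) * (g t - p t)"
        by (simp add: power2_eq_square algebra_simps)
      also have "\<dots> \<le> \<bar>w t * g t\<bar> * \<bar>g t - p t\<bar>"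
        by (metis abs_ge_self abs_mult)
      also have "\<dots> \<le> \<bar>w t * g t\<bar> * e"
        using p(2)[OF t] by (intro mult_left_mono) auto
      finally show "w t * (g t)\<^sup>2 - (w t * p t) * g t \<le> e * (w t * \<bar>g t\<bar>)"
        using w_nonneg[OF t] by (simp add: abs_mult mult_ac)
    qed
    also have "\<dots> = e * K" by (simp add: K_def)
    finally show ?thesis .
  qed
  have nn: "integral {a..b} (\<lambda>t. w t * (g t)\<^sup>2) \<ge> 0"
    by (intro integral_nonneg integrable_continuous_real continuous_intros assms) (auto intro!: mult_nonneg_nonneg w_nonneg)
  have "integral {a..b} (\<lambda>t. w t * (g t)\<^sup>2) \<le> 0"
  proof (rule field_le_epsilon)
    fix e :: real assume "e > 0"
    then have "integral {a..b} (\<lambda>t. w t * (g t)\<^sup>2) \<le> e / (K + 1) * K" using K by (intro bound) auto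
    also have "\<dots> \<le> e" using K \<open>e > 0\<close> by (simp add: field_simps)
    finally show "integral {a..b} (\<lambda>t. w t * (g t)\<^sup>2) \<le> 0 + e" by simp
  qed
  with nn have "integral {a..b} (\<lambda>t. w t * (g t)\<^sup>2) = 0" by simp
  then have zero: "w t * (g t)\<^sup>2 = 0" if "t \<in> {a..b}" for t
    using that \<open>a < b\<close>
    by (subst (asm) integral_eq_0_iff) (auto intro!: continuous_intros assms mult_nonneg_nonneg w_nonneg)
  show ?thesis
  proof (rule continuous_constant_on_closure[where S = "{a<..<b}" and f = g and x = t])
    show "g x = 0" if "x \<in> {a<..<b}" for x using zero[of x] that by (auto simp: w_def)
  qed (use assms t in auto)
qed

section \<open>Motions on a product of spheres\<close>

lemma sphere_projection: "(mat 1 - outer p) *v x = x - (p \<bullet> x) *\<^sub>R p"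
  by (simp add: outer_def columnvector_def rowvector_def matrix_matrix_mult_def
      matrix_vector_mult_def mat_def vec_eq_iff forall_3 sum_3 inner_vec_def algebra_simps)

lemma ang_vel_eq:
  fixes x :: "real \<Rightarrow> real^3^'n"
  assumes "a < b" "t \<in> {a..b}" "(x has_vector_derivative x') (at t within {a..b})"
  shows "ang_vel a b x t = (\<chi> i. cross3 (x t $ i) (x' $ i))"
  using vector_derivative_within_closed_interval[OF assms(1,2) has_vector_derivative_vec_nth[OF assms(3)]]
  by (simp add: ang_vel_def skew_mult)

lemma inner_curve_const:
  assumes "a < b" "t \<in> {a..b}"
    "(x has_vector_derivative x') (at t within {a..b})" "(y has_vector_derivative y') (at t within {a..b})"
    and const: "\<And>s. s \<in> {a..b} \<Longrightarrow> x s \<bullet> y s = c"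
  shows "x' \<bullet> y t + x t \<bullet> y' = 0"
proof -
  have "((\<lambda>s. x s \<bullet> y s) has_vector_derivative x t \<bullet> y' + x' \<bullet> y t) (at t within {a..b})"
    using has_real_derivative_inner[OF assms(3,4)] by (simp add: has_real_derivative_iff_has_vector_derivative)
  moreover have "((\<lambda>s. x s \<bullet> y s) has_vector_derivative 0) (at t within {a..b})"
    by (rule has_vector_derivative_transform[where f = "\<lambda>_. c"]) (use assms in auto)
  ultimately have "x t \<bullet> y' + x' \<bullet> y t = 0"
    using vector_derivative_unique_within_closed_interval[of a b t] assms(1,2) by (metis cbox_interval)
  then show ?thesis by simp
qed

text \<open>Names the derivatives of the motion and of the Lagrangian \<open>F\<close> whose existence \<open>C2_curve\<close> and
\<open>C2_on\<close> assert, so that the velocity of the momentum and its continuity can be written down.\<close>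
locale sphere_motion =
  fixes a b :: real
    and q q' q'' \<omega> f :: "real \<Rightarrow> real^3^'n"
    and U :: "((real^3^'n) \<times> (real^3^'n)) set"
    and F :: "(real^3^'n) \<times> (real^3^'n) \<Rightarrow> real"
    and F' :: "(real^3^'n) \<times> (real^3^'n) \<Rightarrow> ((real^3^'n) \<times> (real^3^'n)) \<Rightarrow>\<^sub>L real"
    and F'' :: "(real^3^'n) \<times> (real^3^'n) \<Rightarrow>
      ((real^3^'n) \<times> (real^3^'n)) \<Rightarrow>\<^sub>L (((real^3^'n) \<times> (real^3^'n)) \<Rightarrow>\<^sub>L real)"
  assumes ab: "a < b"
    and q': "\<And>t. t \<in> {a..b} \<Longrightarrow> (q has_vector_derivative q' t) (at t within {a..b})"
    and q'': "\<And>t. t \<in> {a..b} \<Longrightarrow> (q' has_vector_derivative q'' t) (at t within {a..b})"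
    and cont_q'': "continuous_on {a..b} q''"
    and unit: "\<And>t i. t \<in> {a..b} \<Longrightarrow> norm (q t $ i) = 1"
    and \<omega>: "\<And>t. t \<in> {a..b} \<Longrightarrow> \<omega> t = (\<chi> i. cross3 (q t $ i) (q' t $ i))"
    and cont_f: "continuous_on {a..b} f"
    and phase_U: "phase_set \<subseteq> U"
    and F': "\<And>z. z \<in> U \<Longrightarrow> (F has_derivative blinfun_apply (F' z)) (at z)"
    and F'': "\<And>z. z \<in> U \<Longrightarrow> (F' has_derivative blinfun_apply (F'' z)) (at z)"
    and cont_F'': "continuous_on U F''"
begin

lemma cont_q: "continuous_on {a..b} q"
  using q' by (rule continuous_on_vector_derivative)

lemma cont_q': "continuous_on {a..b} q'"
  using q'' by (rule continuous_on_vector_derivative)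

lemma cont_F: "continuous_on U F"
  using F' by (intro differentiable_imp_continuous_on)
    (auto simp: differentiable_on_def differentiable_def intro: has_derivative_at_withinI)

lemma cont_F': "continuous_on U F'"
  using F'' by (intro differentiable_imp_continuous_on)
    (auto simp: differentiable_on_def differentiable_def intro: has_derivative_at_withinI)

lemma unit_inner: "t \<in> {a..b} \<Longrightarrow> q t $ i \<bullet> q t $ i = 1"
  using unit by (simp add: norm_eq_1)

lemma tangent: "t \<in> {a..b} \<Longrightarrow> q t $ i \<bullet> q' t $ i = 0"
  using inner_curve_const[OF ab _ has_vector_derivative_vec_nth[OF q'] has_vector_derivative_vec_nth[OF q'], of t i i 1]
  by (simp add: unit_inner inner_commute)

lemma cross_in_phase_set:
  assumes "\<And>i. norm (x i) = 1"
  shows "((\<chi> i. x i), (\<chi> i. cross3 (x i) (y i))) \<in> (phase_set :: ((real^3^'n) \<times> (real^3^'n)) set)"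
  using assms by (simp add: phase_set_def spheres_def dot_cross_self)

lemma motion_in_U: "t \<in> {a..b} \<Longrightarrow> (q t, \<omega> t) \<in> U"
  using cross_in_phase_set[of "vec_nth (q t)" "vec_nth (q' t)"] phase_U unit \<omega> by auto

definition \<omega>' :: "real \<Rightarrow> real^3^'n" where
  "\<omega>' t = (\<chi> i. cross3 (q t $ i) (q'' t $ i))"

lemma \<omega>': "t \<in> {a..b} \<Longrightarrow> (\<omega> has_vector_derivative \<omega>' t) (at t within {a..b})"
proof (rule has_vector_derivative_transform[where f = "\<lambda>t. \<chi> i. cross3 (q t $ i) (q' t $ i)"])
  assume t: "t \<in> {a..b}"
  have "((\<lambda>t. cross3 (q t $ i) (q' t $ i)) has_vector_derivative cross3 (q t $ i) (q'' t $ i))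
      (at t within {a..b})" for i
    using has_vector_derivative_cross3[OF has_vector_derivative_vec_nth[OF q'[OF t]]
        has_vector_derivative_vec_nth[OF q''[OF t]], of i i] by simp
  then show "((\<lambda>t. \<chi> i. cross3 (q t $ i) (q' t $ i)) has_vector_derivative \<omega>' t) (at t within {a..b})"
    unfolding \<omega>'_def by (rule has_vector_derivative_vec_lambda)
qed (simp_all add: \<omega>)

lemma cont_\<omega>: "continuous_on {a..b} \<omega>"
  using \<omega>' by (rule continuous_on_vector_derivative)

lemma cont_\<omega>': "continuous_on {a..b} \<omega>'"
  unfolding \<omega>'_def by (intro continuous_intros continuous_on_cross cont_q cont_q'')

text \<open>\<open>p\<close> is the conjugate momentum \<open>\<partial>L/\<partial>\<omega>\<close> along the motion, \<open>p'\<close> its time derivative, and \<open>g\<close> below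
is \<open>\<partial>L/\<partial>q\<close>. The chain rule for \<open>p'\<close> is where the second derivative of \<open>F\<close> is used.\<close>
definition p :: "real \<Rightarrow> real^3^'n" where
  "p t = (\<chi> i. grad_w F i (q t) (\<omega> t))"

definition p' :: "real \<Rightarrow> real^3^'n" where
  "p' t = (\<chi> i. \<Sum>b\<in>Basis. blinfun_apply (blinfun_apply (F'' (q t, \<omega> t)) (q' t, \<omega>' t)) (0, axis i b) *\<^sub>R b)"

lemma p': 
  assumes t: "t \<in> {a..b}"
  shows "(p has_vector_derivative p' t) (at t within {a..b})"
proof (rule has_vector_derivative_transform[OF t])
  show "p s = (\<chi> i. \<Sum>b\<in>Basis. blinfun_apply (F' (q s, \<omega> s)) (0, axis i b) *\<^sub>R b)" if "s \<in> {a..b}" for s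
    unfolding p_def by (subst grad_w_eq_sum[OF F'[OF motion_in_U[OF that]]]) (rule refl)
  have "((\<lambda>s. F' (q s, \<omega> s)) has_vector_derivative blinfun_apply (F'' (q t, \<omega> t)) (q' t, \<omega>' t)) (at t within {a..b})"
    by (rule has_vector_derivative_compose_has_derivative[where F = F' and g = "\<lambda>s. (q s, \<omega> s)", OF _ F''[OF motion_in_U[OF t]]])
      (intro has_vector_derivative_Pair q' \<omega>' t)
  then have "((\<lambda>s. blinfun_apply (F' (q s, \<omega> s)) h) has_vector_derivative
      blinfun_apply (blinfun_apply (F'' (q t, \<omega> t)) (q' t, \<omega>' t)) h) (at t within {a..b})" for h
    by (rule bounded_linear.has_vector_derivative[OF blinfun.bounded_linear_left])
  then show "((\<lambda>s. \<chi> i. \<Sum>b\<in>Basis. blinfun_apply (F' (q s, \<omega> s)) (0, axis i b) *\<^sub>R b)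
      has_vector_derivative p' t) (at t within {a..b})"
    unfolding p'_def
    by (intro has_vector_derivative_vec_lambda has_vector_derivative_sum
        bounded_linear.has_vector_derivative[OF bounded_linear_scaleR_left])
qed

lemma cont_p: "continuous_on {a..b} p"
  using p' by (rule continuous_on_vector_derivative)

lemma cont_p': "continuous_on {a..b} p'"
  unfolding p'_def
  by (intro continuous_intros cont_q' cont_\<omega>' continuous_on_compose2[OF cont_F'' continuous_on_Pair[OF cont_q cont_\<omega>]])
    (use motion_in_U in auto)

definition g :: "real \<Rightarrow> real^3^'n" where
  "g t = (\<chi> i. grad_q F i (q t) (\<omega> t))"

lemma cont_g: "continuous_on {a..b} g"
proof -
  have eq: "g t = (\<chi> i. \<Sum>b\<in>Basis. blinfun_apply (F' (q t, \<omega> t)) (axis i b, 0) *\<^sub>R b)" if "t \<in> {a..b}" for t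
    unfolding g_def by (subst grad_q_eq_sum[OF F'[OF motion_in_U[OF that]]]) (rule refl)
  have "continuous_on {a..b} (\<lambda>t. \<chi> i. \<Sum>b\<in>Basis. blinfun_apply (F' (q t, \<omega> t)) (axis i b, 0) *\<^sub>R b)"
    by (intro continuous_intros continuous_on_compose2[OF cont_F' continuous_on_Pair[OF cont_q cont_\<omega>]])
      (use motion_in_U in auto)
  then show ?thesis by (rule continuous_on_eq) (simp only: eq)
qed

text \<open>The factor of \<open>\<gamma>\<^sub>i\<close> in \<open>\<delta>G + \<delta>W\<close>; only its part tangent to the sphere can be tested.\<close>
definition residual :: "real \<Rightarrow> 'n \<Rightarrow> real^3" where
  "residual t i = cross3 (q t $ i) (g t $ i + f t $ i) - (p' t $ i - 2 *\<^sub>R cross3 (\<omega> t $ i) (p t $ i))"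

lemma cont_residual: "continuous_on {a..b} (\<lambda>t. residual t i)"
  unfolding residual_def
  by (intro continuous_intros continuous_on_cross cont_q cont_p' cont_\<omega> cont_p cont_g cont_f)

section \<open>The first variation of the action\<close>

lemma varied_derivatives:
  assumes adm: "admissible a b q \<gamma>"
    and \<gamma>': "\<And>t. t \<in> {a..b} \<Longrightarrow> (\<gamma> has_vector_derivative \<gamma>' t) (at t within {a..b})"
    and t: "t \<in> {a..b}"
  shows "varied q \<gamma> e t = (\<chi> i. rot e (\<gamma> t $ i) (q t $ i))"
    and "ang_vel a b (varied q \<gamma> e) t = (\<chi> i. ang e (\<gamma> t $ i) (\<gamma>' t $ i) (q t $ i) (q' t $ i))"
proof -
  have *: "varied q \<gamma> e t = (\<chi> i. rot e (\<gamma> t $ i) (q t $ i))" if "t \<in> {a..b}" for t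
    using adm that by (simp add: varied_def admissible_def mexp_skew_eq_rot)
  then show "varied q \<gamma> e t = (\<chi> i. rot e (\<gamma> t $ i) (q t $ i))" using t by blast
  have D: "(varied q \<gamma> e has_vector_derivative (\<chi> i. rot_t e (\<gamma> t $ i) (\<gamma>' t $ i) (q t $ i) (q' t $ i)))
      (at t within {a..b})"
    by (rule has_vector_derivative_transform[OF t *])
      (auto intro!: has_vector_derivative_vec_lambda has_vector_derivative_rot_t has_vector_derivative_vec_nth q' \<gamma>' t)
  show "ang_vel a b (varied q \<gamma> e) t = (\<chi> i. ang e (\<gamma> t $ i) (\<gamma>' t $ i) (q t $ i) (q' t $ i))"
    using ang_vel_eq[OF ab t D] *[OF t] by (simp add: ang_def)
qed

text \<open>Differentiation under the integral sign. The pairs \<open>(Q, W)\<close> below are the varied curve and its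
angular velocity; they lie in \<open>phase_set\<close> for all \<open>e\<close>, so the rule applies with \<open>e\<close> ranging over
the whole line.\<close>
lemma action_derivative:
  assumes adm: "admissible a b q \<gamma>"
    and \<gamma>': "\<And>t. t \<in> {a..b} \<Longrightarrow> (\<gamma> has_vector_derivative \<gamma>' t) (at t within {a..b})"
    and cont_\<gamma>': "continuous_on {a..b} \<gamma>'"
  shows "((\<lambda>e. action F a b (varied q \<gamma> e)) has_real_derivative
    integral {a..b} (\<lambda>t. \<Sum>i\<in>UNIV. g t $ i \<bullet> cross3 (\<gamma> t $ i) (q t $ i)
      + p t $ i \<bullet> (\<gamma>' t $ i - 2 *\<^sub>R cross3 (\<omega> t $ i) (\<gamma> t $ i)))) (at 0)"
proof -
  define Q where "Q e t = (\<chi> i. rot e (\<gamma> t $ i) (q t $ i))" for e t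
  define Qe where "Qe e t = (\<chi> i. rot_e e (\<gamma> t $ i) (q t $ i))" for e t
  define W where "W e t = (\<chi> i. ang e (\<gamma> t $ i) (\<gamma>' t $ i) (q t $ i) (q' t $ i))" for e t
  define We where "We e t = (\<chi> i. ang_e e (\<gamma> t $ i) (\<gamma>' t $ i) (q t $ i) (q' t $ i))" for e t
  have perp: "\<gamma> t $ i \<bullet> q t $ i = 0" if "t \<in> {a..b}" for t i
    using adm that by (simp add: admissible_def)
  have cont_\<gamma>: "continuous_on {a..b} \<gamma>"
    using \<gamma>' by (rule continuous_on_vector_derivative)
  have QW: "(Q e t, W e t) \<in> U" if "t \<in> {a..b}" for e t
    unfolding Q_def W_def ang_def
    by (rule subsetD[OF phase_U cross_in_phase_set], rule norm_rot[OF perp[OF that] unit[OF that]])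
  have action: "action F a b (varied q \<gamma> e) = integral {a..b} (\<lambda>t. F (Q e t, W e t))" for e
    unfolding action_def Q_def W_def
    by (intro integral_cong) (simp only: varied_derivatives[OF adm \<gamma>'])
  have cont2: "continuous_on S (\<lambda>z. Q (e z) (s z))" "continuous_on S (\<lambda>z. Qe (e z) (s z))"
      "continuous_on S (\<lambda>z. W (e z) (s z))" "continuous_on S (\<lambda>z. We (e z) (s z))"
    if "continuous_on S e" "continuous_on S s" "s ` S \<subseteq> {a..b}" for S and e s :: "'z::t2_space \<Rightarrow> real"
    unfolding Q_def Qe_def W_def We_def
    by (intro continuous_on_vec_lambda continuous_on_rot continuous_on_ang that(1) continuous_intros
        continuous_on_compose2[OF cont_\<gamma> that(2,3)] continuous_on_compose2[OF cont_\<gamma>' that(2,3)]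
        continuous_on_compose2[OF cont_q that(2,3)] continuous_on_compose2[OF cont_q' that(2,3)])+
  have "((\<lambda>e. integral (cbox a b) (\<lambda>t. F (Q e t, W e t))) has_real_derivative
      integral (cbox a b) (\<lambda>t. blinfun_apply (F' (Q 0 t, W 0 t)) (Qe 0 t, We 0 t))) (at 0 within UNIV)"
  proof (rule leibniz_rule_field_derivative)
    fix e t assume "t \<in> cbox a b"
    then have t: "t \<in> {a..b}" by simp
    have "((\<lambda>e. (Q e t, W e t)) has_vector_derivative (Qe e t, We e t)) (at e)"
      unfolding Q_def Qe_def W_def We_def
      by (intro has_vector_derivative_Pair has_vector_derivative_vec_lambda
          has_vector_derivative_rot_e has_vector_derivative_ang_e)
    then show "((\<lambda>e. F (Q e t, W e t)) has_real_derivative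
        blinfun_apply (F' (Q e t, W e t)) (Qe e t, We e t)) (at e within UNIV)"
      unfolding has_real_derivative_iff_has_vector_derivative
      by (rule has_vector_derivative_compose_has_derivative[where F = F and g = "\<lambda>e. (Q e t, W e t)", OF _ F'[OF QW[OF t]]])
  next
    show "(\<lambda>t. F (Q e t, W e t)) integrable_on cbox a b" for e
      by (intro integrable_continuous continuous_on_compose2[OF cont_F] continuous_on_Pair cont2)
        (auto intro: QW)
  next
    show "continuous_on (UNIV \<times> cbox a b) (\<lambda>(e, t). blinfun_apply (F' (Q e t, W e t)) (Qe e t, We e t))"
      unfolding split_beta
      by (intro bounded_bilinear.continuous_on[OF bounded_bilinear_blinfun_apply] continuous_on_compose2[OF cont_F'] continuous_on_Pair cont2
          continuous_on_fst continuous_on_snd continuous_on_id) (auto intro: QW)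
  qed auto
  moreover have "blinfun_apply (F' (Q 0 t, W 0 t)) (Qe 0 t, We 0 t) =
      (\<Sum>i\<in>UNIV. g t $ i \<bullet> cross3 (\<gamma> t $ i) (q t $ i)
      + p t $ i \<bullet> (\<gamma>' t $ i - 2 *\<^sub>R cross3 (\<omega> t $ i) (\<gamma> t $ i)))" if t: "t \<in> {a..b}" for t
  proof -
    have *: "Q 0 t = q t" "W 0 t = \<omega> t" by (simp_all add: Q_def W_def \<omega>[OF t])
    have "\<gamma>' t $ i \<bullet> q t $ i + \<gamma> t $ i \<bullet> q' t $ i = 0" for i
      by (rule inner_curve_const[OF ab t has_vector_derivative_vec_nth[OF \<gamma>'[OF t]]
            has_vector_derivative_vec_nth[OF q'[OF t]] perp])
    then have We: "We 0 t $ i = \<gamma>' t $ i - 2 *\<^sub>R cross3 (\<omega> t $ i) (\<gamma> t $ i)" for i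
      unfolding We_def vec_lambda_beta using ang_e_0_perp unit_inner tangent perp t
      by (simp add: \<omega>[OF t] del: rot_at_0)
    show ?thesis
      unfolding * derivative_eq_sum_grads[OF F'[OF motion_in_U[OF t]]] We
      by (simp add: Qe_def g_def p_def)
  qed
  then have "integral {a..b} (\<lambda>t. blinfun_apply (F' (Q 0 t, W 0 t)) (Qe 0 t, We 0 t)) =
      integral {a..b} (\<lambda>t. \<Sum>i\<in>UNIV. g t $ i \<bullet> cross3 (\<gamma> t $ i) (q t $ i)
      + p t $ i \<bullet> (\<gamma>' t $ i - 2 *\<^sub>R cross3 (\<omega> t $ i) (\<gamma> t $ i)))"
    by (rule integral_cong)
  ultimately show ?thesis
    by (simp only: action cbox_interval)
qed

text \<open>The time derivative moves from \<open>\<gamma>\<close> to \<open>p\<close>, and the triple products are rotated so that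
\<open>\<gamma>\<^sub>i\<close> stands in front.\<close>
lemma first_variation_by_parts:
  assumes adm: "admissible a b q \<gamma>"
    and \<gamma>': "\<And>t. t \<in> {a..b} \<Longrightarrow> (\<gamma> has_vector_derivative \<gamma>' t) (at t within {a..b})"
    and cont_\<gamma>': "continuous_on {a..b} \<gamma>'"
  shows "integral {a..b} (\<lambda>t. \<Sum>i\<in>UNIV. g t $ i \<bullet> cross3 (\<gamma> t $ i) (q t $ i)
      + p t $ i \<bullet> (\<gamma>' t $ i - 2 *\<^sub>R cross3 (\<omega> t $ i) (\<gamma> t $ i))) + virtual_work f a b q \<gamma>
    = integral {a..b} (\<lambda>t. \<Sum>i\<in>UNIV. \<gamma> t $ i \<bullet> residual t i)"
proof -
  have cont_\<gamma>: "continuous_on {a..b} \<gamma>"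
    using \<gamma>' by (rule continuous_on_vector_derivative)
  note ci = continuous_intros continuous_on_cross cont_q cont_p' cont_\<omega> cont_p cont_g cont_f
      cont_\<gamma> cont_\<gamma>' cont_residual
  have "((\<lambda>t. p t \<bullet> \<gamma>' t + p' t \<bullet> \<gamma> t) has_integral (p b \<bullet> \<gamma> b - p a \<bullet> \<gamma> a)) {a..b}"
    using ab has_real_derivative_inner[OF p' \<gamma>']
    by (intro fundamental_theorem_of_calculus) (auto simp: has_real_derivative_iff_has_vector_derivative)
  then have parts: "integral {a..b} (\<lambda>t. p t \<bullet> \<gamma>' t + p' t \<bullet> \<gamma> t) = 0"
    using adm by (simp add: admissible_def integral_unique)
  let ?A = "\<lambda>t. \<Sum>i\<in>UNIV. g t $ i \<bullet> cross3 (\<gamma> t $ i) (q t $ i)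
      + p t $ i \<bullet> (\<gamma>' t $ i - 2 *\<^sub>R cross3 (\<omega> t $ i) (\<gamma> t $ i))"
  let ?V = "\<lambda>t. \<Sum>i\<in>UNIV. f t $ i \<bullet> cross3 (\<gamma> t $ i) (q t $ i)"
  have triple: "x \<bullet> cross3 y z = y \<bullet> cross3 z x" for x y z
    using cross_triple[of y z x] by (simp add: inner_commute)
  have "?A t + ?V t = (\<Sum>i\<in>UNIV. \<gamma> t $ i \<bullet> residual t i) + (p t \<bullet> \<gamma>' t + p' t \<bullet> \<gamma> t)" for t
    unfolding inner_vec_def[of "p t"] inner_vec_def[of "p' t"] sum.distrib[symmetric]
  proof (rule sum.cong)
    fix i
    show "g t $ i \<bullet> cross3 (\<gamma> t $ i) (q t $ i)
        + p t $ i \<bullet> (\<gamma>' t $ i - 2 *\<^sub>R cross3 (\<omega> t $ i) (\<gamma> t $ i)) + f t $ i \<bullet> cross3 (\<gamma> t $ i) (q t $ i)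
      = \<gamma> t $ i \<bullet> residual t i + (p t $ i \<bullet> \<gamma>' t $ i + p' t $ i \<bullet> \<gamma> t $ i)"
      using triple[of "g t $ i" "\<gamma> t $ i" "q t $ i"] triple[of "f t $ i" "\<gamma> t $ i" "q t $ i"]
        triple[of "\<gamma> t $ i" "p t $ i" "\<omega> t $ i"] cross_skew[of "\<omega> t $ i" "p t $ i"]
      by (simp add: residual_def inner_diff_right inner_add_right cross_add_right inner_commute)
  qed simp
  then have "integral {a..b} (\<lambda>t. ?A t + ?V t)
      = integral {a..b} (\<lambda>t. (\<Sum>i\<in>UNIV. \<gamma> t $ i \<bullet> residual t i) + (p t \<bullet> \<gamma>' t + p' t \<bullet> \<gamma> t))"
    by simp
  moreover have "integral {a..b} (\<lambda>t. ?A t + ?V t) = integral {a..b} ?A + integral {a..b} ?V"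
    by (intro integral_add integrable_continuous_real ci)
  moreover have "integral {a..b} (\<lambda>t. (\<Sum>i\<in>UNIV. \<gamma> t $ i \<bullet> residual t i) + (p t \<bullet> \<gamma>' t + p' t \<bullet> \<gamma> t))
      = integral {a..b} (\<lambda>t. \<Sum>i\<in>UNIV. \<gamma> t $ i \<bullet> residual t i) + integral {a..b} (\<lambda>t. p t \<bullet> \<gamma>' t + p' t \<bullet> \<gamma> t)"
    by (intro integral_add integrable_continuous_real ci)
  ultimately show ?thesis
    by (simp add: virtual_work_def skew_mult parts)
qed

section \<open>From the integral identity to the pointwise equations\<close>

lemma lagrange_dalembert_iff_integral:
  "lagrange_dalembert F f a b q \<longleftrightarrow>
    (\<forall>\<gamma>. admissible a b q \<gamma> \<longrightarrow> integral {a..b} (\<lambda>t. \<Sum>i\<in>UNIV. \<gamma> t $ i \<bullet> residual t i) = 0)"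
  unfolding lagrange_dalembert_def
proof (intro all_cong)
  fix \<gamma> :: "real \<Rightarrow> real^3^'n"
  assume adm: "admissible a b q \<gamma>"
  then obtain \<gamma>' where \<gamma>': "\<And>t. t \<in> {a..b} \<Longrightarrow> (\<gamma> has_vector_derivative \<gamma>' t) (at t within {a..b})"
    and cont_\<gamma>': "continuous_on {a..b} \<gamma>'"
    unfolding admissible_def C1_curve_def by blast
  note D = action_derivative[OF adm \<gamma>' cont_\<gamma>'] and parts = first_variation_by_parts[OF adm \<gamma>' cont_\<gamma>']
  show "((\<lambda>e. action F a b (varied q \<gamma> e)) has_real_derivative - virtual_work f a b q \<gamma>) (at 0) \<longleftrightarrow>
      integral {a..b} (\<lambda>t. \<Sum>i\<in>UNIV. \<gamma> t $ i \<bullet> residual t i) = 0"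
  proof
    assume "((\<lambda>e. action F a b (varied q \<gamma> e)) has_real_derivative - virtual_work f a b q \<gamma>) (at 0)"
    from DERIV_unique[OF D this] parts
    show "integral {a..b} (\<lambda>t. \<Sum>i\<in>UNIV. \<gamma> t $ i \<bullet> residual t i) = 0" by linarith
  next
    assume "integral {a..b} (\<lambda>t. \<Sum>i\<in>UNIV. \<gamma> t $ i \<bullet> residual t i) = 0"
    with parts have "integral {a..b} (\<lambda>t. \<Sum>i\<in>UNIV. g t $ i \<bullet> cross3 (\<gamma> t $ i) (q t $ i)
        + p t $ i \<bullet> (\<gamma>' t $ i - 2 *\<^sub>R cross3 (\<omega> t $ i) (\<gamma> t $ i))) = - virtual_work f a b q \<gamma>"
      by linarith
    with D show "((\<lambda>e. action F a b (varied q \<gamma> e)) has_real_derivative - virtual_work f a b q \<gamma>) (at 0)"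
      by simp
  qed
qed

text \<open>If the projection vanishes, then \<open>residual\<close> is parallel to \<open>q\<^sub>i\<close> and perpendicular to every \<open>\<gamma>\<^sub>i\<close>.
Conversely, the variations \<open>\<phi> (I - q q\<^sup>T) v\<close> of a single body reduce the claim to the scalar
fundamental lemma, since the projection is symmetric and can be moved from \<open>v\<close> to \<open>residual\<close>.\<close>
lemma integral_zero_iff_projection:
  "(\<forall>\<gamma>. admissible a b q \<gamma> \<longrightarrow> integral {a..b} (\<lambda>t. \<Sum>i\<in>UNIV. \<gamma> t $ i \<bullet> residual t i) = 0) \<longleftrightarrow>
    (\<forall>i. \<forall>t\<in>{a..b}. residual t i - (q t $ i \<bullet> residual t i) *\<^sub>R q t $ i = 0)" (is "?L \<longleftrightarrow> ?R")
proof
  assume ?R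
  show ?L
  proof (intro allI impI)
    fix \<gamma> assume "admissible a b q \<gamma>"
    then have "\<gamma> t $ i \<bullet> residual t i = 0" if "t \<in> {a..b}" for t i
    proof -
      have "residual t i = (q t $ i \<bullet> residual t i) *\<^sub>R q t $ i" using \<open>?R\<close> that by simp
      then have "\<gamma> t $ i \<bullet> residual t i = (q t $ i \<bullet> residual t i) * (\<gamma> t $ i \<bullet> q t $ i)" by (metis inner_scaleR_right)
      then show ?thesis using \<open>admissible a b q \<gamma>\<close> that by (simp add: admissible_def)
    qed
    then have "integral {a..b} (\<lambda>t. \<Sum>i\<in>UNIV. \<gamma> t $ i \<bullet> residual t i) = integral {a..b} (\<lambda>t. 0)"
      by (intro integral_cong sum.neutral) blast
    then show "integral {a..b} (\<lambda>t. \<Sum>i\<in>UNIV. \<gamma> t $ i \<bullet> residual t i) = 0" by simp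
  qed
next
  assume L: ?L
  show ?R
  proof (intro allI ballI)
    fix i t assume t: "t \<in> {a..b}"
    let ?P = "\<lambda>t v. v - (q t $ i \<bullet> v) *\<^sub>R q t $ i"
    have "v \<bullet> ?P t (residual t i) = 0" for v
    proof (rule fundamental_lemma_C1[OF ab _ _ t])
      show "continuous_on {a..b} (\<lambda>t. v \<bullet> ?P t (residual t i))"
        by (intro continuous_intros cont_residual cont_q)
    next
      fix \<phi> \<phi>' :: "real \<Rightarrow> real"
      assume \<phi>: "\<And>t. (\<phi> has_real_derivative \<phi>' t) (at t)" "continuous_on UNIV \<phi>'" "\<phi> a = 0" "\<phi> b = 0"
      define \<gamma> :: "real \<Rightarrow> real^3^'n" where "\<gamma> t = axis i (\<phi> t *\<^sub>R ?P t v)" for t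
      define P' where "P' t = - ((q t $ i \<bullet> v) *\<^sub>R q' t $ i + (q' t $ i \<bullet> v) *\<^sub>R q t $ i)" for t
      have "admissible a b q \<gamma>"
        unfolding admissible_def
      proof (intro conjI ballI allI)
        show "\<gamma> a = 0" "\<gamma> b = 0" using \<phi> by (simp_all add: \<gamma>_def vec_eq_iff axis_def)
        show "\<gamma> t $ j \<bullet> q t $ j = 0" if "t \<in> {a..b}" for t j
          using unit_inner[OF that, of i]
          by (simp add: \<gamma>_def axis_def inner_diff_left inner_diff_right inner_commute)
        show "C1_curve a b \<gamma>"
          unfolding C1_curve_def
        proof (intro exI conjI ballI)
          show "(\<gamma> has_vector_derivative axis i (\<phi> t *\<^sub>R P' t + \<phi>' t *\<^sub>R ?P t v)) (at t within {a..b})"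
            if "t \<in> {a..b}" for t
          proof -
            have P: "((\<lambda>t. ?P t v) has_vector_derivative P' t) (at t within {a..b})"
              using has_vector_derivative_vec_nth[OF q'[OF that], of i]
                has_real_derivative_inner[OF has_vector_derivative_vec_nth[OF q'[OF that], of i]
                  has_vector_derivative_const[of v]]
              unfolding P'_def by (auto intro!: derivative_eq_intros)
            show ?thesis
              unfolding \<gamma>_def
              by (rule bounded_linear.has_vector_derivative[OF bounded_linear_axis
                    has_vector_derivative_scaleR[OF has_field_derivative_at_within[OF \<phi>(1)] P]])
          qed
          have "continuous_on {a..b} \<phi>"
            by (rule DERIV_continuous_on[OF has_field_derivative_at_within[OF \<phi>(1)]])
          moreover have "continuous_on {a..b} \<phi>'"
            by (rule continuous_on_subset[OF \<phi>(2)]) simp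
          ultimately show "continuous_on {a..b} (\<lambda>t. axis i (\<phi> t *\<^sub>R P' t + \<phi>' t *\<^sub>R ?P t v) :: real^3^'n)"
            unfolding P'_def
            by (intro bounded_linear.continuous_on[OF bounded_linear_axis] continuous_intros cont_q cont_q')
        qed
      qed
      then have "integral {a..b} (\<lambda>t. \<Sum>j\<in>UNIV. \<gamma> t $ j \<bullet> residual t j) = 0" using L by blast
      moreover have "(\<Sum>j\<in>UNIV. \<gamma> t $ j \<bullet> residual t j) = \<phi> t * (v \<bullet> ?P t (residual t i))" for t
      proof -
        have "(\<Sum>j\<in>UNIV. \<gamma> t $ j \<bullet> residual t j) = (\<Sum>j\<in>UNIV. if j = i then (\<phi> t *\<^sub>R ?P t v) \<bullet> residual t j else 0)"
          by (intro sum.cong) (auto simp: \<gamma>_def axis_def)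
        also have "\<dots> = \<phi> t * (v \<bullet> ?P t (residual t i))"
          by (simp add: inner_diff_left inner_diff_right inner_commute)
        finally show ?thesis .
      qed
      ultimately show "integral {a..b} (\<lambda>t. \<phi> t * (v \<bullet> ?P t (residual t i))) = 0" by simp
    qed
    then show "?P t (residual t i) = 0" by (metis inner_eq_zero_iff)
  qed
qed

text \<open>The projection fixes \<open>q \<times> (g + f)\<close>, which is perpendicular to \<open>q\<close>, so that it may be applied to the whole left-hand side.\<close>
lemma euler_lagrange_residual:
  assumes t: "t \<in> {a..b}"
  shows "(mat 1 - outer (q t $ i)) *v
        (time_deriv a b (\<lambda>s. grad_w F i (q s) (\<omega> s)) t
          - 2 *\<^sub>R (skew (\<omega> t $ i) *v grad_w F i (q t) (\<omega> t)))
      - skew (q t $ i) *v (grad_q F i (q t) (\<omega> t) + f t $ i)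
    = - (residual t i - (q t $ i \<bullet> residual t i) *\<^sub>R q t $ i)"
proof -
  have "time_deriv a b (\<lambda>s. p s $ i) t = p' t $ i"
    by (rule vector_derivative_within_closed_interval[OF ab t has_vector_derivative_vec_nth[OF p'[OF t]]])
  then show ?thesis
    unfolding sphere_projection skew_mult
    by (simp add: p_def g_def residual_def inner_diff_right inner_add_right dot_cross_self algebra_simps)
qed

end

theorem proposition2:
  fixes L Lt :: "(real^3^'n) \<times> (real^3^'n) \<Rightarrow> real"
    and U :: "((real^3^'n) \<times> (real^3^'n)) set"
    and q \<omega> f :: "real \<Rightarrow> real^3^'n"
    and t0 tf :: real
  assumes "t0 < tf"
    and "modified_lagrangian L U Lt"
    and "C2_curve t0 tf q"
    and "\<forall>t\<in>{t0..tf}. q t \<in> spheres"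
    and "\<forall>t\<in>{t0..tf}. \<omega> t = ang_vel t0 tf q t"
    and "continuous_on {t0..tf} f"
  shows "lagrange_dalembert Lt f t0 tf q \<longleftrightarrow>
    (\<forall>i. \<forall>t\<in>{t0..tf}.
      (mat 1 - outer (q t $ i)) *v
        (time_deriv t0 tf (\<lambda>s. grad_w Lt i (q s) (\<omega> s)) t
          - 2 *\<^sub>R (skew (\<omega> t $ i) *v grad_w Lt i (q t) (\<omega> t)))
      - skew (q t $ i) *v (grad_q Lt i (q t) (\<omega> t) + f t $ i) = 0)"
proof -
  obtain q' q'' where q': "\<forall>t\<in>{t0..tf}. (q has_vector_derivative q' t) (at t within {t0..tf})"
    and q'': "\<forall>t\<in>{t0..tf}. (q' has_vector_derivative q'' t) (at t within {t0..tf})"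
      "continuous_on {t0..tf} q''"
    using assms(3) unfolding C2_curve_def C1_curve_def by blast
  obtain F' F'' where F': "\<forall>z\<in>U. (Lt has_derivative blinfun_apply (F' z)) (at z)"
    and F'': "\<forall>z\<in>U. (F' has_derivative blinfun_apply (F'' z)) (at z)" "continuous_on U F''"
    using assms(2) unfolding modified_lagrangian_def C2_on_def by blast
  interpret sphere_motion t0 tf q q' q'' \<omega> f U Lt F' F''
  proof unfold_locales
    show "phase_set \<subseteq> U" using assms(2) by (simp add: modified_lagrangian_def)
    show "norm (q t $ i) = 1" if "t \<in> {t0..tf}" for t i
      using assms(4) that by (auto simp: spheres_def)
    show "\<omega> t = (\<chi> i. cross3 (q t $ i) (q' t $ i))" if "t \<in> {t0..tf}" for t
      using assms(5) ang_vel_eq[OF assms(1) that q'[rule_format, OF that]] that by auto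
  qed (use assms q' q'' F' F'' in auto)
  show ?thesis
    unfolding lagrange_dalembert_iff_integral integral_zero_iff_projection
    by (simp only: euler_lagrange_residual neg_equal_0_iff_equal cong: ball_cong)
qed

end
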